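(* Let $R\in\operatorname{Ob}(\hat{\mathcal C})$ with residue field $k\notin\{\mathbb F_2,\mathbb F_3,\mathbb F_5\}$, $G=\mathrm{SL}_2(R)$, $\bar\rho:G\to\mathrm{GL}_2(k)$ induced by reduction, and $\iota:G\hookrightarrow\mathrm{GL}_2(R)$ the inclusion. Then $\iota$ is a universal lift of $\bar\rho$.
   Context: Let $k$ be a finite field. $\hat{\mathcal C}$ is the category of complete noetherian local commutative rings with residue field $k$, with local homomorphisms inducing the identity on $k$; $\mathfrak m_S$ is the maximal ideal of $S$. For a profinite group $G$ and continuous $\bar\rho:G\to\mathrm{GL}_n(k)$, a lift to $S$ is a continuous $\rho:G\to\mathrm{GL}_n(S)$ reducing to $\bar\rho$; lifts are strictly equivalent if conjugate by an element of $I+M_n(\mathfrak m_S)$; $\mathrm{Def}_{\bar\rho}(S)$ is the set of strict equivalence classes. A lift $\rho$ to $R$ is universal if $f\mapsto[\mathrm{GL}_n(f)\circ\rho]$ ($\mathrm{GL}_n(f)$ applies $f$ entrywise) is a natural isomorphism $\mathrm{Hom}_{\hat{\mathcal C}}(R,-)\to\mathrm{Def}_{\bar\rho}$. $\mathrm{SL}_n(R)$ carries its profinite topology. *)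

theory Defs
  imports Main "Jordan_Normal_Form.Determinant"
begin

definition is_ideal :: "'a::comm_ring_1 set \<Rightarrow> bool" where
  "is_ideal I \<longleftrightarrow> 0 \<in> I \<and> (\<forall>x\<in>I. \<forall>y\<in>I. x + y \<in> I) \<and> (\<forall>x\<in>I. \<forall>r. r * x \<in> I)"

definition ideal_gen :: "'a::comm_ring_1 set \<Rightarrow> 'a set" where
  "ideal_gen X = \<Inter>{I. is_ideal I \<and> X \<subseteq> I}"

fun ideal_pow :: "'a::comm_ring_1 set \<Rightarrow> nat \<Rightarrow> 'a set" where
  "ideal_pow I 0 = UNIV"
| "ideal_pow I (Suc n) = ideal_gen {a * b | a b. a \<in> I \<and> b \<in> ideal_pow I n}"

definition maximal_ideal :: "'a::comm_ring_1 set \<Rightarrow> bool" where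
  "maximal_ideal m \<longleftrightarrow> is_ideal m \<and> m \<noteq> UNIV \<and>
     (\<forall>I. is_ideal I \<and> m \<subseteq> I \<longrightarrow> I = m \<or> I = UNIV)"

definition local_ring :: "'a::comm_ring_1 itself \<Rightarrow> bool" where
  "local_ring TYPE('a) \<longleftrightarrow> (\<exists>!m::'a set. maximal_ideal m)"

definition noetherian_ring :: "'a::comm_ring_1 itself \<Rightarrow> bool" where
  "noetherian_ring TYPE('a) \<longleftrightarrow>
     (\<forall>I::'a set. is_ideal I \<longrightarrow> (\<exists>F. finite F \<and> I = ideal_gen F))"

definition adically_complete :: "'a::comm_ring_1 set \<Rightarrow> bool" where
  "adically_complete m \<longleftrightarrow>
     (\<Inter>N. ideal_pow m N) = {0} \<and>
     (\<forall>x::nat \<Rightarrow> 'a. (\<forall>N. \<exists>K. \<forall>i\<ge>K. \<forall>j\<ge>K. x i - x j \<in> ideal_pow m N) \<longrightarrow>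
        (\<exists>l. \<forall>N. \<exists>K. \<forall>i\<ge>K. x i - l \<in> ideal_pow m N))"

text \<open>An object of C-hat: the ring is the type 'a, together with the identification
  of its residue field with the fixed finite field 'k, i.e. a surjective ring
  homomorphism pi onto 'k whose kernel is the maximal ideal.\<close>

definition ring_hom_tc :: "('a::comm_ring_1 \<Rightarrow> 'b::comm_ring_1) \<Rightarrow> bool" where
  "ring_hom_tc f \<longleftrightarrow> (\<forall>x y. f (x + y) = f x + f y) \<and> (\<forall>x y. f (x * y) = f x * f y) \<and> f 1 = 1"

definition max_ideal :: "('a::comm_ring_1 \<Rightarrow> 'k::field) \<Rightarrow> 'a set" where
  "max_ideal \<pi> = {x. \<pi> x = 0}"

definition in_C :: "('a::comm_ring_1 \<Rightarrow> 'k::{field,finite}) \<Rightarrow> bool" where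
  "in_C \<pi> \<longleftrightarrow> local_ring TYPE('a) \<and> noetherian_ring TYPE('a) \<and>
     ring_hom_tc \<pi> \<and> surj \<pi> \<and> maximal_ideal (max_ideal \<pi>) \<and>
     adically_complete (max_ideal \<pi>)"

definition Hom_C :: "('a::comm_ring_1 \<Rightarrow> 'k::{field,finite}) \<Rightarrow> ('b::comm_ring_1 \<Rightarrow> 'k)
     \<Rightarrow> ('a \<Rightarrow> 'b) set" where
  "Hom_C \<pi>R \<pi>S = {f. ring_hom_tc f \<and> f ` max_ideal \<pi>R \<subseteq> max_ideal \<pi>S \<and> (\<forall>x. \<pi>S (f x) = \<pi>R x)}"

definition mat_cong :: "'a::comm_ring_1 set \<Rightarrow> nat \<Rightarrow> 'a mat \<Rightarrow> 'a mat \<Rightarrow> bool" where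
  "mat_cong m N A B \<longleftrightarrow> dim_row A = dim_row B \<and> dim_col A = dim_col B \<and>
     (\<forall>i<dim_row A. \<forall>j<dim_col A. A $$ (i, j) - B $$ (i, j) \<in> ideal_pow m N)"

definition SL2 :: "'a::comm_ring_1 itself \<Rightarrow> 'a mat set" where
  "SL2 TYPE('a) = {A \<in> carrier_mat 2 2. det A = 1}"

text \<open>Continuity of a map between matrix groups, both carrying the adic
  (= profinite) topologies of their coefficient rings.\<close>
definition adic_continuous :: "'a::comm_ring_1 set \<Rightarrow> 'a mat set \<Rightarrow> 'b::comm_ring_1 set
     \<Rightarrow> ('a mat \<Rightarrow> 'b mat) \<Rightarrow> bool" where
  "adic_continuous mR G mS \<rho> \<longleftrightarrow>
     (\<forall>g\<in>G. \<forall>N. \<exists>M. \<forall>h\<in>G. mat_cong mR M h g \<longrightarrow> mat_cong mS N (\<rho> h) (\<rho> g))"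

definition is_lift :: "('a::comm_ring_1 \<Rightarrow> 'k::{field,finite}) \<Rightarrow> 'a mat set \<Rightarrow> ('a mat \<Rightarrow> 'k mat)
     \<Rightarrow> nat \<Rightarrow> ('b::comm_ring_1 \<Rightarrow> 'k) \<Rightarrow> ('a mat \<Rightarrow> 'b mat) \<Rightarrow> bool" where
  "is_lift \<pi>R G \<rho>bar n \<pi>S \<rho> \<longleftrightarrow>
     (\<forall>g\<in>G. \<rho> g \<in> carrier_mat n n \<and> invertible_mat (\<rho> g)) \<and>
     (\<forall>g\<in>G. \<forall>h\<in>G. \<rho> (g * h) = \<rho> g * \<rho> h) \<and>
     adic_continuous (max_ideal \<pi>R) G (max_ideal \<pi>S) \<rho> \<and>
     (\<forall>g\<in>G. map_mat \<pi>S (\<rho> g) = \<rho>bar g)"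

definition strictly_equiv :: "('b::comm_ring_1 \<Rightarrow> 'k::{field,finite}) \<Rightarrow> nat \<Rightarrow> 'a mat set
     \<Rightarrow> ('a mat \<Rightarrow> 'b mat) \<Rightarrow> ('a mat \<Rightarrow> 'b mat) \<Rightarrow> bool" where
  "strictly_equiv \<pi>S n G \<rho> \<rho>' \<longleftrightarrow>
     (\<exists>P Q. P \<in> carrier_mat n n \<and> Q \<in> carrier_mat n n \<and>
        P * Q = 1\<^sub>m n \<and> Q * P = 1\<^sub>m n \<and>
        (\<forall>i<n. \<forall>j<n. (P - 1\<^sub>m n) $$ (i, j) \<in> max_ideal \<pi>S) \<and>
        (\<forall>g\<in>G. \<rho>' g = P * \<rho> g * Q))"

definition lift_rel :: "('a::comm_ring_1 \<Rightarrow> 'k::{field,finite}) \<Rightarrow> 'a mat set \<Rightarrow> ('a mat \<Rightarrow> 'k mat)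
     \<Rightarrow> nat \<Rightarrow> ('b::comm_ring_1 \<Rightarrow> 'k) \<Rightarrow> (('a mat \<Rightarrow> 'b mat) \<times> ('a mat \<Rightarrow> 'b mat)) set" where
  "lift_rel \<pi>R G \<rho>bar n \<pi>S = {(\<rho>, \<rho>'). is_lift \<pi>R G \<rho>bar n \<pi>S \<rho> \<and> is_lift \<pi>R G \<rho>bar n \<pi>S \<rho>' \<and>
      strictly_equiv \<pi>S n G \<rho> \<rho>'}"

definition Def_lifts :: "('a::comm_ring_1 \<Rightarrow> 'k::{field,finite}) \<Rightarrow> 'a mat set \<Rightarrow> ('a mat \<Rightarrow> 'k mat)
     \<Rightarrow> nat \<Rightarrow> ('b::comm_ring_1 \<Rightarrow> 'k) \<Rightarrow> ('a mat \<Rightarrow> 'b mat) set set" where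
  "Def_lifts \<pi>R G \<rho>bar n \<pi>S = {\<rho>. is_lift \<pi>R G \<rho>bar n \<pi>S \<rho>} // lift_rel \<pi>R G \<rho>bar n \<pi>S"

definition induced_class :: "('a::comm_ring_1 \<Rightarrow> 'k::{field,finite}) \<Rightarrow> 'a mat set \<Rightarrow> ('a mat \<Rightarrow> 'k mat)
     \<Rightarrow> nat \<Rightarrow> ('b::comm_ring_1 \<Rightarrow> 'k) \<Rightarrow> ('a mat \<Rightarrow> 'c::comm_ring_1 mat) \<Rightarrow> ('c \<Rightarrow> 'b)
     \<Rightarrow> ('a mat \<Rightarrow> 'b mat) set" where
  "induced_class \<pi>R G \<rho>bar n \<pi>S \<rho> f = lift_rel \<pi>R G \<rho>bar n \<pi>S `` {(\<lambda>g. map_mat f (\<rho> g))}"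

end

theory Submission
  imports Defs "HOL-Computational_Algebra.Polynomial"
begin

text \<open>Injectivity follows from traces. For surjectivity, let \<open>\<rho>\<close> be a lift and choose a unit \<open>a\<close>
  of \<open>R\<close> whose residue satisfies \<open>x^4 \<noteq> 1\<close>; this is where the fields with 2, 3 and 5 elements
  drop out. By Hensel's lemma \<open>\<rho> (diag (a, 1/a))\<close> becomes diagonal after strict conjugation.
  Since \<open>\<rho>\<close> of an upper unipotent matrix commutes with its conjugates under this diagonal matrix,
  it is upper unipotent, with entry \<open>q r\<close> say, and similarly for lower ones. A diagonal conjugation
  gives \<open>q 1 = 1\<close>. The relation \<open>u(r) l(-1/r) u(r) = l(-1/r) u(r) l(-1/r)\<close>, which holds for all
  units \<open>r\<close>, shows that the lower entry is also given by \<open>q\<close> and that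
  \<open>\<rho> (diag (r, 1/r)) = diag (q r, 1 / q r)\<close>. Hence \<open>q\<close> is multiplicative on units, and it is a ring
  homomorphism because every element of \<open>R\<close> is a sum of two units. Elementary matrices generate
  \<open>SL\<^sub>2(R)\<close>, so \<open>\<rho>\<close> is entrywise \<open>q\<close>.\<close>

section \<open>Powers of an ideal\<close>

lemma is_ideal_ideal_gen: "is_ideal (ideal_gen X)"
  unfolding is_ideal_def ideal_gen_def by auto

lemma ideal_gen_superset: "X \<subseteq> ideal_gen X"
  unfolding ideal_gen_def by auto

lemma ideal_gen_least: "is_ideal I \<Longrightarrow> X \<subseteq> I \<Longrightarrow> ideal_gen X \<subseteq> I"
  unfolding ideal_gen_def by auto

lemma is_ideal_ideal_pow: "is_ideal (ideal_pow I N)"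
  by (cases N) (auto simp: is_ideal_ideal_gen, simp add: is_ideal_def)

lemma ideal_pow_mult: "a \<in> I \<Longrightarrow> b \<in> ideal_pow I N \<Longrightarrow> a * b \<in> ideal_pow I (Suc N)"
  using ideal_gen_superset by fastforce

lemma ideal_pow_add: "x \<in> ideal_pow I N \<Longrightarrow> y \<in> ideal_pow I N \<Longrightarrow> x + y \<in> ideal_pow I N"
  using is_ideal_ideal_pow unfolding is_ideal_def by blast

lemma ideal_pow_mult_left: "x \<in> ideal_pow I N \<Longrightarrow> r * x \<in> ideal_pow I N"
  using is_ideal_ideal_pow unfolding is_ideal_def by blast

lemma ideal_pow_uminus: "x \<in> ideal_pow I N \<Longrightarrow> - x \<in> ideal_pow I N"
  using ideal_pow_mult_left[of x I N "-1"] by simp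

lemma ideal_pow_zero: "0 \<in> ideal_pow I N"
  using is_ideal_ideal_pow unfolding is_ideal_def by blast

lemma ideal_pow_Suc_subset: "ideal_pow I (Suc N) \<subseteq> ideal_pow I N"
proof -
  have "ideal_gen {a * b | a b. a \<in> I \<and> b \<in> ideal_pow I N} \<subseteq> ideal_pow I N"
    by (rule ideal_gen_least[OF is_ideal_ideal_pow]) (auto intro: ideal_pow_mult_left)
  then show ?thesis by simp
qed

section \<open>Completeness: fixed points and units\<close>

text \<open>Banach's fixed point argument for the adic topology: the iterates of \<open>F\<close>
  from 0 form a Cauchy sequence, and their limit is fixed. It supplies both inverses and the
  Hensel-type root in \<open>diagonalize\<close>.\<close>

lemma contraction_fixpoint:
  fixes F :: "'a::comm_ring_1 \<Rightarrow> 'a"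
  assumes compl: "adically_complete m"
    and contr: "\<And>N x y. x - y \<in> ideal_pow m N \<Longrightarrow> F x - F y \<in> ideal_pow m (Suc N)"
  shows "\<exists>x. F x = x"
proof -
  define X where "X n = (F ^^ n) 0" for n
  have X_Suc: "X (Suc n) = F (X n)" for n by (simp add: X_def)
  \<comment> \<open>The induction starts for free because the zeroth power is the whole ring; each
    application of \<open>F\<close> gains one power.\<close>
  have close: "X (n + k) - X n \<in> ideal_pow m n" for n k
  proof (induction n)
    case 0
    show ?case by simp
  next
    case (Suc n)
    from contr[OF this] show ?case by (simp add: X_Suc)
  qed
  have cauchy: "\<exists>K. \<forall>i\<ge>K. \<forall>j\<ge>K. X i - X j \<in> ideal_pow m N" for N
  proof (intro exI[of _ N] allI impI)
    fix i j assume "N \<le> i" "N \<le> j"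
    then have "X i - X N \<in> ideal_pow m N" "X j - X N \<in> ideal_pow m N"
      using close[of N "i - N"] close[of N "j - N"] by auto
    from ideal_pow_add[OF this(1) ideal_pow_uminus[OF this(2)]]
    show "X i - X j \<in> ideal_pow m N" by simp
  qed
  obtain l where l: "\<And>N. \<exists>K. \<forall>i\<ge>K. X i - l \<in> ideal_pow m N"
  proof -
    have "(\<forall>N. \<exists>K. \<forall>i\<ge>K. \<forall>j\<ge>K. X i - X j \<in> ideal_pow m N) \<longrightarrow>
        (\<exists>l. \<forall>N. \<exists>K. \<forall>i\<ge>K. X i - l \<in> ideal_pow m N)"
      using compl unfolding adically_complete_def by (elim conjE allE[of _ X])
    then show thesis using cauchy that by blast
  qed
  \<comment> \<open>Write \<open>F l - l = (X (Suc K) - l) - (F (X K) - F l)\<close>. Lying in every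
    power then forces this to be 0, by separatedness.\<close>
  have "F l - l \<in> ideal_pow m N" for N
  proof -
    obtain K where K: "\<forall>i\<ge>K. X i - l \<in> ideal_pow m N" using l by blast
    then have "X (Suc K) - l \<in> ideal_pow m N" by simp
    moreover have "F (X K) - F l \<in> ideal_pow m N"
      using contr[of "X K" l N] K ideal_pow_Suc_subset by blast
    ultimately show ?thesis
      using ideal_pow_add[OF _ ideal_pow_uminus, of "X (Suc K) - l" m N "F (X K) - F l"]
      by (simp add: X_Suc)
  qed
  then have "F l - l \<in> (\<Inter>N. ideal_pow m N)" by blast
  then show ?thesis using compl unfolding adically_complete_def by auto
qed

lemma ring_hom_tcD:
  assumes "ring_hom_tc f"
  shows "f (x + y) = f x + f y" "f (x * y) = f x * f y" "f 1 = 1" "f 0 = 0"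
    "f (- x) = - f x" "f (x - y) = f x - f y"
proof -
  show add: "f (x + y) = f x + f y" for x y using assms by (simp add: ring_hom_tc_def)
  show "f (x * y) = f x * f y" "f 1 = 1" using assms by (simp_all add: ring_hom_tc_def)
  show z: "f 0 = 0" using add[of 0 0] by simp
  show m: "f (- x) = - f x" for x using add[of x "- x"] z by (simp add: eq_neg_iff_add_eq_0 add.commute)
  show "f (x - y) = f x - f y" using add[of x "- y"] m[of y] by simp
qed

text \<open>If \<open>y\<close> lifts the inverse residue, then \<open>x * y = 1 - z\<close> with
  \<open>z\<close> in the maximal ideal, and the fixed point of \<open>w = 1 + z * w\<close> inverts
  \<open>1 - z\<close>; it is the geometric series in \<open>z\<close>.\<close>

lemma in_C_unit:
  assumes "in_C \<pi>" and "\<pi> x \<noteq> 0"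
  shows "x dvd 1"
proof -
  have h: "ring_hom_tc \<pi>" and s: "surj \<pi>" and c: "adically_complete (max_ideal \<pi>)"
    using assms(1) by (auto simp: in_C_def)
  obtain y where y: "\<pi> y = inverse (\<pi> x)" using s by (metis surjD)
  let ?z = "1 - x * y"
  have z: "?z \<in> max_ideal \<pi>" using assms(2) by (simp add: max_ideal_def ring_hom_tcD[OF h] y)
  have "\<exists>w. 1 + ?z * w = w"
  proof (rule contraction_fixpoint[OF c])
    fix N v w assume "v - w \<in> ideal_pow (max_ideal \<pi>) N"
    from ideal_pow_mult[OF z this]
    show "1 + ?z * v - (1 + ?z * w) \<in> ideal_pow (max_ideal \<pi>) (Suc N)"
      by (simp only: right_diff_distrib add_diff_cancel_left)
  qed
  then obtain w where "1 + ?z * w = w" ..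
  then have "1 = x * (y * w)" by (simp add: algebra_simps)
  then show ?thesis by (rule dvdI)
qed

text \<open>The coefficient rings may have zero divisors, so all cancellations below are by
  units.\<close>

lemma unit_mult_eq_0D:
  fixes x y :: "'a::comm_ring_1"
  assumes "x dvd 1" "x * y = 0"
  shows "y = 0"
proof -
  obtain z where "1 = x * z" using assms(1) by (rule dvdE)
  then have "y = z * (x * y)" by (metis mult.assoc mult.commute mult_1)
  then show ?thesis using assms(2) by simp
qed

lemma unit_mult_left_cancel:
  fixes x y z :: "'a::comm_ring_1"
  assumes "x dvd 1" "x * y = x * z"
  shows "y = z"
  using unit_mult_eq_0D[OF assms(1), of "y - z"] assms(2) by (simp add: right_diff_distrib)

section \<open>Explicit 2 by 2 matrices and conjugation\<close>

text \<open>With named entries, \<open>mat2_mult\<close> and \<open>mat2_eq_iff\<close> rewrite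
  matrix identities into ring identities.\<close>

definition mat2 :: "'a \<Rightarrow> 'a \<Rightarrow> 'a \<Rightarrow> 'a \<Rightarrow> 'a mat" where
  "mat2 a b c d = mat 2 2 (\<lambda>(i, j). if i = 0 then (if j = 0 then a else b) else (if j = 0 then c else d))"

lemma mat2_carrier [simp]: "mat2 a b c d \<in> carrier_mat 2 2"
  by (simp add: mat2_def)

lemma mat2_dim [simp]: "dim_row (mat2 a b c d) = 2" "dim_col (mat2 a b c d) = 2"
  by (simp_all add: mat2_def)

lemma mat2_index [simp]:
  "mat2 a b c d $$ (0, 0) = a" "mat2 a b c d $$ (0, Suc 0) = b"
  "mat2 a b c d $$ (Suc 0, 0) = c" "mat2 a b c d $$ (Suc 0, Suc 0) = d"
  by (simp_all add: mat2_def)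

lemma mat2_eq_iff [simp]:
  "mat2 a b c d = mat2 a' b' c' d' \<longleftrightarrow> a = a' \<and> b = b' \<and> c = c' \<and> d = d'"
  by (metis mat2_index)

lemma mat2_expand:
  "A \<in> carrier_mat 2 2 \<Longrightarrow> A = mat2 (A $$ (0,0)) (A $$ (0,1)) (A $$ (1,0)) (A $$ (1,1))"
  by (rule eq_matI) (auto simp: mat2_def less_2_cases_iff)

lemma mat2_mult [simp]:
  fixes a :: "'a::comm_ring_1"
  shows "mat2 a b c d * mat2 a' b' c' d' =
    mat2 (a * a' + b * c') (a * b' + b * d') (c * a' + d * c') (c * b' + d * d')"
  by (rule eq_matI) (auto simp: mat2_def scalar_prod_def less_2_cases_iff numeral_2_eq_2)

lemma one_mat2: "1\<^sub>m 2 = mat2 1 0 0 1"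
  by (rule eq_matI) (auto simp: mat2_def less_2_cases_iff)

lemma det_mat2: "det (mat2 a b c d) = a * d - b * (c :: 'a::comm_ring_1)"
  by (subst laplace_expansion_column[of _ 2 0])
    (auto simp: cofactor_def numeral_2_eq_2 mat_delete_def det_single[of _] mat2_def)

lemma map_mat_mat2 [simp]: "map_mat f (mat2 a b c d) = mat2 (f a) (f b) (f c) (f d)"
  by (rule eq_matI) (auto simp: mat2_def less_2_cases_iff)

lemma mat2_in_SL2 [simp]: "mat2 a b c d \<in> SL2 TYPE('a::comm_ring_1) \<longleftrightarrow> a * d - b * c = 1"
  by (simp add: SL2_def det_mat2)

lemma SL2_mult: "g \<in> SL2 TYPE('a::comm_ring_1) \<Longrightarrow> h \<in> SL2 TYPE('a) \<Longrightarrow> g * h \<in> SL2 TYPE('a)"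
  by (auto simp: SL2_def det_mult)

lemma SL2_cases:
  assumes "g \<in> SL2 TYPE('a::comm_ring_1)"
  obtains a b c d where "g = mat2 a b c d" "a * d - b * c = 1"
proof -
  have g: "g \<in> carrier_mat 2 2" using assms by (simp add: SL2_def)
  from mat2_expand[OF g] mat2_in_SL2 assms that show thesis by metis
qed

lemma map_mat_mult_2:
  assumes "ring_hom_tc f" "A \<in> carrier_mat 2 2" "B \<in> carrier_mat 2 2"
  shows "map_mat f (A * B) = map_mat f A * map_mat f B"
  by (subst (1 2) mat2_expand[OF assms(2)], subst (1 2) mat2_expand[OF assms(3)])
    (simp add: ring_hom_tcD[OF assms(1)])

lemma conj_conj:
  fixes P :: "'a::comm_ring_1 mat"
  assumes "P \<in> carrier_mat n n" "P' \<in> carrier_mat n n" "Q \<in> carrier_mat n n" "Q' \<in> carrier_mat n n"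
    and "A \<in> carrier_mat n n"
  shows "(P' * P) * A * (Q * Q') = P' * (P * A * Q) * Q'"
  using assms by (simp add: assoc_mult_mat[of _ n n _ n _ n])

lemma conj_mult:
  fixes P :: "'a::comm_ring_1 mat"
  assumes "P \<in> carrier_mat n n" "Q \<in> carrier_mat n n" "A \<in> carrier_mat n n" "B \<in> carrier_mat n n"
    and "Q * P = 1\<^sub>m n"
  shows "(P * A * Q) * (P * B * Q) = P * (A * B) * Q"
proof -
  have "(P * A * Q) * (P * B * Q) = P * A * (Q * P) * (B * Q)"
    using assms(1-4) by (simp add: assoc_mult_mat[of _ n n _ n _ n])
  also have "\<dots> = P * (A * B) * Q"
    unfolding assms(5) using assms(1-4) by (simp add: assoc_mult_mat[of _ n n _ n _ n])
  finally show ?thesis .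
qed

section \<open>Images of unipotent matrices and diagonalization\<close>

text \<open>A torus element acting on the additive group by \<open>v\<close> acts on the off-diagonal entries by
  \<open>t\<close> and \<open>t'\<close>; that the images of \<open>r\<close> and \<open>v * r\<close> commute then forces the
  image of a unit \<open>r\<close> to be a scalar times a unipotent matrix, and the scalar is a character
  of \<open>v\<close>-coinvariants, which vanish.\<close>

lemma unipotent_entries:
  fixes p q c d :: "'a::comm_ring_1 \<Rightarrow> 'b::comm_ring_1"
  assumes add_p: "\<And>r s. p (r + s) = p r * p s + q r * c s"
    and add_q: "\<And>r s. q (r + s) = p r * q s + q r * d s"
    and add_c: "\<And>r s. c (r + s) = c r * p s + d r * c s"
    and add_d: "\<And>r s. d (r + s) = c r * q s + d r * d s"
    and act: "\<And>r. p (v * r) = p r" "\<And>r. d (v * r) = d r"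
      "\<And>r. q (v * r) = t * q r" "\<And>r. c (v * r) = t' * c r"
    and t: "t * t' = 1" "t - 1 dvd 1" "t + 1 dvd 1" and v: "v - 1 dvd 1"
    and unit_q: "\<And>r. r dvd 1 \<Longrightarrow> q r dvd 1" and unit_p: "\<And>r. p r dvd 1"
    and sum: "\<And>r::'a. \<exists>s s'. s dvd 1 \<and> s' dvd 1 \<and> r = s + s'"
  shows "c r = 0" "p r = 1" "d r = 1"
proof -
  have unit: "c r = 0 \<and> p r = d r" if "r dvd 1" for r
  proof
    note qr = unit_q[OF that]
    \<comment> \<open>The upper left entry for \<open>r + v * r\<close>, computed in both orders.
      Multiplied by \<open>t\<close>, the identity says \<open>(t^2 - 1) * q r * c r = 0\<close>,
      where \<open>t - 1\<close>, \<open>t + 1\<close> and \<open>q r\<close> are units.\<close>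
    have "q r * (t' * c r) = t * q r * c r"
      using add_p[of r "v * r"] add_p[of "v * r" r] by (simp add: act add.commute)
    then have "t * (q r * (t' * c r)) = t * (t * q r * c r)" by simp
    then have "(t * t') * (q r * c r) = t * t * (q r * c r)" by (simp add: ac_simps)
    then have "(t - 1) * ((t + 1) * (q r * c r)) = 0" by (simp add: t(1) algebra_simps)
    then show "c r = 0" using unit_mult_eq_0D t qr by blast
    \<comment> \<open>The same comparison for the upper right entry.\<close>
    have "p r * (t * q r) + q r * d r = p r * q r + t * q r * d r"
      using add_q[of r "v * r"] add_q[of "v * r" r] by (simp add: act add.commute)
    then have "(t - 1) * (q r * (p r - d r)) = 0" by (simp add: algebra_simps)
    then have "p r - d r = 0" using unit_mult_eq_0D t qr by blast
    then show "p r = d r" by simp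
  qed
  have cpd: "c r = 0 \<and> p r = d r" for r
  proof -
    obtain s s' where s: "s dvd 1" "s' dvd 1" "r = s + s'" using sum by blast
    show ?thesis using unit[OF s(1)] unit[OF s(2)] by (simp add: s(3) add_p add_d add_c)
  qed
  have p1: "p r = 1" for r
  proof -
    \<comment> \<open>With \<open>c = 0\<close>, \<open>p\<close> is a character of the additive
      group, and \<open>r = v * s - s\<close> for \<open>s = w * r\<close>, while
      \<open>p (v * s) = p s\<close>.\<close>
    obtain w where w: "1 = (v - 1) * w" using v by (rule dvdE)
    have "p (w * r + (v - 1) * (w * r)) = p (v * (w * r))" by (simp add: algebra_simps)
    then have "p (w * r) * p ((v - 1) * (w * r)) = p (w * r) * 1"
      using add_p[of "w * r" "(v - 1) * (w * r)"] cpd by (simp add: act)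
    then have "p ((v - 1) * w * r) = 1" 
      using unit_mult_left_cancel[OF unit_p] by (metis mult.assoc)
    then show ?thesis by (simp flip: w)
  qed
  show "c r = 0" "p r = 1" "d r = 1" using cpd[of r] p1[of r] by simp_all
qed

text \<open>Distinct residues make \<open>a - d\<close> a unit. A lower unipotent conjugation clears
  the lower left entry, which needs a root of a quadratic equation; an upper one then clears the
  other entry, which is a linear problem.\<close>

lemma diagonalize:
  assumes C: "in_C \<pi>" and M: "M \<in> carrier_mat 2 2"
    and red: "map_mat \<pi> M = mat2 x 0 0 y" and "x \<noteq> y"
  obtains P Q \<alpha> \<delta> where "P \<in> carrier_mat 2 2" "Q \<in> carrier_mat 2 2" "P * Q = 1\<^sub>m 2" "Q * P = 1\<^sub>m 2"
    "map_mat \<pi> P = 1\<^sub>m 2" "P * M * Q = mat2 \<alpha> 0 0 \<delta>"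
proof -
  have h: "ring_hom_tc \<pi>" and compl: "adically_complete (max_ideal \<pi>)"
    using C by (auto simp: in_C_def)
  note hom = ring_hom_tcD[OF h]
  obtain a b c d where Meq: "M = mat2 a b c d" using mat2_expand[OF M] by blast
  have r: "\<pi> a = x" "\<pi> b = 0" "\<pi> c = 0" "\<pi> d = y" using red by (simp_all add: Meq)
  have "a - d dvd 1" by (rule in_C_unit[OF C]) (use r \<open>x \<noteq> y\<close> in \<open>simp add: hom\<close>)
  then obtain u where u: "1 = (a - d) * u" by (rule dvdE)
  \<comment> \<open>The vector \<open>(1, z)\<close> is an eigenvector of \<open>M\<close> exactly
    when \<open>b * z^2 + (a - d) * z = c\<close>. Divided by \<open>a - d\<close>, this is a fixed
    point equation, contracting because \<open>b\<close> lies in the maximal ideal.\<close>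
  have "\<exists>z. u * (c - b * z * z) = z"
  proof (rule contraction_fixpoint[OF compl])
    fix N v w assume vw: "v - w \<in> ideal_pow (max_ideal \<pi>) N"
    have "b \<in> max_ideal \<pi>" by (simp add: max_ideal_def r)
    from ideal_pow_mult_left[OF ideal_pow_mult[OF this vw], of "- u * (v + w)"]
    moreover have "- u * (v + w) * (b * (v - w)) = u * (c - b * v * v) - u * (c - b * w * w)"
      by (simp add: algebra_simps)
    ultimately show "u * (c - b * v * v) - u * (c - b * w * w) \<in> ideal_pow (max_ideal \<pi>) (Suc N)"
      by (simp only:)
  qed
  then obtain z where z: "u * (c - b * z * z) = z" ..
  have "(a - d) * z = (a - d) * (u * (c - b * z * z))" by (simp only: z)
  also have "\<dots> = (a - d) * u * (c - b * z * z)" by (simp only: mult.assoc)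
  finally have "(a - d) * z = c - b * z * z" by (simp flip: u)
  then have ev: "c + d * z = z * (a + b * z)" by (simp add: algebra_simps)
  have \<pi>z: "\<pi> z = 0" by (subst z[symmetric]) (simp add: hom r)
  \<comment> \<open>The diagonal entries after the first conjugation. Their residues are still
    \<open>x\<close> and \<open>y\<close>, so \<open>(?\<alpha> - ?\<delta>) * s = b\<close> can be
    solved for the parameter of the second one.\<close>
  let ?\<alpha> = "a + b * z" and ?\<delta> = "d - z * b"
  have "?\<alpha> - ?\<delta> dvd 1" by (rule in_C_unit[OF C]) (use r \<pi>z \<open>x \<noteq> y\<close> in \<open>simp add: hom\<close>)
  then obtain e where e: "1 = (?\<alpha> - ?\<delta>) * e" by (rule dvdE)
  define s where "s = b * e"
  have \<pi>s: "\<pi> s = 0" by (simp add: s_def hom r)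
  have s: "(?\<alpha> - ?\<delta>) * s = b" unfolding s_def by (metis e mult.assoc mult.commute mult_1)
  let ?P = "mat2 1 s 0 1 * mat2 1 0 (- z) 1" and ?Q = "mat2 1 0 z 1 * mat2 1 (- s) 0 1"
  have lower: "mat2 1 0 (- z) 1 * M * mat2 1 0 z 1 = mat2 ?\<alpha> b 0 ?\<delta>"
    using ev by (simp add: Meq algebra_simps)
  have upper: "mat2 1 s 0 1 * mat2 ?\<alpha> b 0 ?\<delta> * mat2 1 (- s) 0 1 = mat2 ?\<alpha> 0 0 ?\<delta>"
    using s by (simp add: algebra_simps)
  show ?thesis
  proof (rule that[of ?P ?Q ?\<alpha> ?\<delta>])
    have "?P * M * ?Q = mat2 1 s 0 1 * (mat2 1 0 (- z) 1 * M * mat2 1 0 z 1) * mat2 1 (- s) 0 1"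
      by (rule conj_conj[where n = 2]) (use M in simp_all)
    then show "?P * M * ?Q = mat2 ?\<alpha> 0 0 ?\<delta>" by (simp only: lower upper)
  qed (simp_all add: one_mat2 hom \<pi>z \<pi>s algebra_simps)
qed


section \<open>The ring homomorphism attached to a normalized lift\<close>

text \<open>The conditions \<open>diag\<close> and \<open>norm\<close> are what two strict
  conjugations achieve for any lift. The homomorphism is then read off as the upper right entry of
  \<open>\<rho>\<close> on upper unipotent matrices.\<close>

lemma hom_of_normalized_lift:
  fixes \<pi>R :: "'a::comm_ring_1 \<Rightarrow> 'k::{field,finite}" and \<pi>S :: "'b::comm_ring_1 \<Rightarrow> 'k"
  assumes CR: "in_C \<pi>R" and CS: "in_C \<pi>S"
    and mult: "\<And>g h. g \<in> SL2 TYPE('a) \<Longrightarrow> h \<in> SL2 TYPE('a) \<Longrightarrow> \<rho> (g * h) = \<rho> g * \<rho> h"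
    and car: "\<And>g. g \<in> SL2 TYPE('a) \<Longrightarrow> \<rho> g \<in> carrier_mat 2 2"
    and red: "\<And>g. g \<in> SL2 TYPE('a) \<Longrightarrow> map_mat \<pi>S (\<rho> g) = map_mat \<pi>R g"
    and a: "a * a' = 1" "\<pi>R a ^ 4 \<noteq> 1"
    and diag: "\<rho> (mat2 a 0 0 a') = mat2 \<alpha> 0 0 \<delta>"
    and norm: "\<rho> (mat2 1 1 0 1) $$ (0, 1) = 1"
  obtains f where "f \<in> Hom_C \<pi>R \<pi>S" "\<And>g. g \<in> SL2 TYPE('a) \<Longrightarrow> \<rho> g = map_mat f g"
proof -
  have hR: "ring_hom_tc \<pi>R" and hS: "ring_hom_tc \<pi>S" using CR CS by (auto simp: in_C_def)
  note homR = ring_hom_tcD[OF hR] and homS = ring_hom_tcD[OF hS]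
  define x where "x = \<pi>R a"
  have x4: "x ^ 4 \<noteq> 1" using a by (simp add: x_def)
  have x_inv: "x * \<pi>R a' = 1" using a(1) homR(2)[of a a'] by (simp add: homR x_def)
  have x0: "x \<noteq> 0" using x_inv by auto
  have a'0: "\<pi>R a' \<noteq> 0" using x_inv by auto
  \<comment> \<open>Both factors of \<open>x^4 - 1 = (x^2 - 1) * (x^2 + 1)\<close> are nonzero. They
    are the residues of \<open>t - 1\<close> and \<open>t + 1\<close> below, and the first is also
    that of \<open>a * a - 1\<close>.\<close>
  have x2: "x * x \<noteq> 1" "x * x \<noteq> - 1"
    using x4 by (auto simp: power4_eq_xxxx mult.assoc)
  have x1: "x \<noteq> 1" using x2 by auto
  have unit_iff: "r dvd 1 \<longleftrightarrow> \<pi>R r \<noteq> 0" for r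
    using in_C_unit[OF CR, of r] homR(2,3) by (metis dvdE mult_zero_left zero_neq_one)
  have unitS: "r dvd 1" if "\<pi>S r \<noteq> 0" for r using in_C_unit[OF CS that] .
  \<comment> \<open>A non-unit splits as \<open>1 + (r - 1)\<close>, a unit as
    \<open>a * r + (1 - a) * r\<close>, since \<open>x\<close> is neither 0 nor 1.\<close>
  have sum: "\<exists>s s'. s dvd 1 \<and> s' dvd 1 \<and> r = s + s'" for r :: 'a
  proof (cases "\<pi>R r = 0")
    case True
    then show ?thesis
      by (intro exI[of _ 1] exI[of _ "r - 1"]) (simp add: unit_iff homR)
  next
    case False
    then show ?thesis using x0 x1
      by (intro exI[of _ "a * r"] exI[of _ "(1 - a) * r"])
        (simp add: unit_iff homR algebra_simps flip: x_def)
  qed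
  have red\<alpha>: "\<pi>S \<alpha> = x" and red\<delta>: "\<pi>S \<delta> = \<pi>R a'"
    using red[of "mat2 a 0 0 a'"] a(1) by (simp_all add: diag x_def)
  obtain \<alpha>' where \<alpha>': "\<alpha> * \<alpha>' = 1" using unitS[of \<alpha>] x0 by (auto simp: red\<alpha> elim: dvdE)
  obtain \<delta>' where \<delta>': "\<delta> * \<delta>' = 1"
    using unitS[of \<delta>] a'0 by (auto simp: red\<delta> elim: dvdE)
  \<comment> \<open>Conjugation by \<open>diag (\<alpha>, \<delta>)\<close> scales the off-diagonal
    entries by \<open>\<alpha> / \<delta>\<close> and its inverse; at this point
    \<open>\<delta>\<close> is not yet known to be \<open>1 / \<alpha>\<close>.\<close>
  define t t' where "t = \<alpha> * \<delta>'" and "t' = \<delta> * \<alpha>'"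
  have tt': "t * t' = 1" using \<alpha>' \<delta>' by (simp add: t_def t'_def ac_simps)
  have "\<pi>S \<delta>' = x"
    using \<delta>' homS(2)[of \<delta> \<delta>'] x_inv by (metis homS(3) mult.assoc mult.commute mult_1 red\<delta>)
  then have red_t: "\<pi>S t = x * x" by (simp add: t_def homS red\<alpha>)
  have units_t: "t - 1 dvd 1" "t + 1 dvd 1"
    using x2 by (auto intro!: unitS simp: homS red_t eq_neg_iff_add_eq_0)
  have unit_v: "a * a - 1 dvd 1"
    using x2 by (simp add: unit_iff homR flip: x_def)
  have entries: "\<rho> g = mat2 (\<rho> g $$ (0,0)) (\<rho> g $$ (0,1)) (\<rho> g $$ (1,0)) (\<rho> g $$ (1,1))"
    if "g \<in> SL2 TYPE('a)" for g using mat2_expand[OF car[OF that]] .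

  \<comment> \<open>Images of upper unipotent matrices\<close>
  define p q c d where "p r = \<rho> (mat2 1 r 0 1) $$ (0,0)" and "q r = \<rho> (mat2 1 r 0 1) $$ (0,1)"
    and "c r = \<rho> (mat2 1 r 0 1) $$ (1,0)" and "d r = \<rho> (mat2 1 r 0 1) $$ (1,1)" for r
  have \<rho>U: "\<rho> (mat2 1 r 0 1) = mat2 (p r) (q r) (c r) (d r)" for r
    using entries[of "mat2 1 r 0 1"] by (simp add: p_def q_def c_def d_def)
  have U_add: "mat2 (p (r + s)) (q (r + s)) (c (r + s)) (d (r + s)) =
      mat2 (p r) (q r) (c r) (d r) * mat2 (p s) (q s) (c s) (d s)" for r s
    using mult[of "mat2 1 r 0 1" "mat2 1 s 0 1"] by (simp add: \<rho>U add.commute)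
  have U_act: "mat2 \<alpha> 0 0 \<delta> * mat2 (p r) (q r) (c r) (d r) =
      mat2 (p (a * a * r)) (q (a * a * r)) (c (a * a * r)) (d (a * a * r)) * mat2 \<alpha> 0 0 \<delta>" for r
  proof -
    have "mat2 a 0 0 a' * mat2 1 r 0 1 = mat2 1 (a * a * r) 0 1 * mat2 a 0 0 a'"
      using a(1) by simp (metis mult.assoc mult.commute mult_1)
    from arg_cong[OF this, of \<rho>] show ?thesis
      using a(1) by (simp add: mult diag \<rho>U del: mat2_mult)
  qed
  have cancel\<alpha>: "y = z" if "\<alpha> * y = z * \<alpha>" for y z
    using that unit_mult_left_cancel[of \<alpha> y z] unitS[of \<alpha>] x0 by (simp add: red\<alpha> mult.commute)
  have cancel\<delta>: "y = z" if "\<delta> * y = z * \<delta>" for y z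
    using that unit_mult_left_cancel[of \<delta> y z] unitS[of \<delta>] a'0 by (simp add: red\<delta> mult.commute)
  have U_act_entries: "p (a * a * r) = p r" "d (a * a * r) = d r"
    "q (a * a * r) = t * q r" "c (a * a * r) = t' * c r" for r
  proof -
    note e = U_act[of r, simplified]
    show "p (a * a * r) = p r" "d (a * a * r) = d r" using e cancel\<alpha> cancel\<delta> by metis+
    have "\<alpha> * q r * \<delta>' = q (a * a * r) * (\<delta> * \<delta>')" using e by (simp add: mult.assoc)
    then show "q (a * a * r) = t * q r" by (simp add: \<delta>' t_def ac_simps)
    have "\<delta> * c r * \<alpha>' = c (a * a * r) * (\<alpha> * \<alpha>')" using e by (simp add: mult.assoc)
    then show "c (a * a * r) = t' * c r" by (simp add: \<alpha>' t'_def ac_simps)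
  qed
  have redU: "\<pi>S (p r) = 1" "\<pi>S (q r) = \<pi>R r" "\<pi>S (c r) = 0" "\<pi>S (d r) = 1" for r
    using red[of "mat2 1 r 0 1"] by (simp_all add: \<rho>U homR)
  have U: "c r = 0" "p r = 1" "d r = 1" for r
    by (rule unipotent_entries[where p = p and q = q and c = c and d = d and v = "a * a" and
          t = t and t' = t', OF _ _ _ _ U_act_entries tt' units_t unit_v _ _ sum];
        use U_add in \<open>auto intro!: unitS simp: redU unit_iff\<close>)+

  \<comment> \<open>Images of lower unipotent matrices\<close>
  define p' q' c' d' where "p' r = \<rho> (mat2 1 0 r 1) $$ (0,0)" and "q' r = \<rho> (mat2 1 0 r 1) $$ (0,1)"
    and "c' r = \<rho> (mat2 1 0 r 1) $$ (1,0)" and "d' r = \<rho> (mat2 1 0 r 1) $$ (1,1)" for r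
  have \<rho>L: "\<rho> (mat2 1 0 r 1) = mat2 (p' r) (q' r) (c' r) (d' r)" for r
    using entries[of "mat2 1 0 r 1"] by (simp add: p'_def q'_def c'_def d'_def)
  have L_add: "mat2 (p' (r + s)) (q' (r + s)) (c' (r + s)) (d' (r + s)) =
      mat2 (p' r) (q' r) (c' r) (d' r) * mat2 (p' s) (q' s) (c' s) (d' s)" for r s
    using mult[of "mat2 1 0 r 1" "mat2 1 0 s 1"] by (simp add: \<rho>L add.commute)
  \<comment> \<open>The torus element scales lower unipotents by the inverse of
    \<open>a * a\<close>. Placing \<open>a * a * r\<close> on the left of the relation keeps the
    multiplier \<open>a * a\<close> and the same \<open>t\<close>.\<close>
  have L_act: "mat2 \<alpha> 0 0 \<delta> * mat2 (p' (a * a * r)) (q' (a * a * r)) (c' (a * a * r)) (d' (a * a * r)) =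
      mat2 (p' r) (q' r) (c' r) (d' r) * mat2 \<alpha> 0 0 \<delta>" for r
  proof -
    have "mat2 a 0 0 a' * mat2 1 0 (a * a * r) 1 = mat2 1 0 r 1 * mat2 a 0 0 a'"
      using a(1) by simp (metis mult.assoc mult.commute mult_1)
    from arg_cong[OF this, of \<rho>] show ?thesis
      using a(1) by (simp add: mult diag \<rho>L del: mat2_mult)
  qed
  have L_act_entries: "d' (a * a * r) = d' r" "p' (a * a * r) = p' r"
    "c' (a * a * r) = t * c' r" "q' (a * a * r) = t' * q' r" for r
  proof -
    note e = L_act[of r, simplified]
    show "d' (a * a * r) = d' r" "p' (a * a * r) = p' r" using e cancel\<alpha> cancel\<delta> by metis+
    have "\<alpha> * q' (a * a * r) * \<alpha>' = q' r * \<delta> * \<alpha>'" using e by simp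
    then have "\<alpha> * \<alpha>' * q' (a * a * r) = t' * q' r" by (simp add: t'_def ac_simps)
    then show "q' (a * a * r) = t' * q' r" by (simp add: \<alpha>')
    have "\<delta> * c' (a * a * r) * \<delta>' = c' r * \<alpha> * \<delta>'" using e by simp
    then have "\<delta> * \<delta>' * c' (a * a * r) = t * c' r" by (simp add: t_def ac_simps)
    then show "c' (a * a * r) = t * c' r" by (simp add: \<delta>')
  qed
  have redL: "\<pi>S (p' r) = 1" "\<pi>S (q' r) = 0" "\<pi>S (c' r) = \<pi>R r" "\<pi>S (d' r) = 1" for r
    using red[of "mat2 1 0 r 1"] by (simp_all add: \<rho>L homR)
  have L: "q' r = 0" "d' r = 1" "p' r = 1" for r
    \<comment> \<open>Swapping the two coordinates makes lower matrices upper: \<open>d'\<close> and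
      \<open>p'\<close> trade places, as do \<open>c'\<close> and \<open>q'\<close>.\<close>
    by (rule unipotent_entries[where p = d' and q = c' and c = q' and d = p' and v = "a * a" and
          t = t and t' = t', OF _ _ _ _ L_act_entries tt' units_t unit_v _ _ sum];
        use L_add in \<open>auto intro!: unitS simp: redL unit_iff add.commute\<close>)+

  have \<rho>U: "\<rho> (mat2 1 r 0 1) = mat2 1 (q r) 0 1" for r using \<rho>U[of r] by (simp add: U)
  have \<rho>L: "\<rho> (mat2 1 0 r 1) = mat2 1 0 (c' r) 1" for r using \<rho>L[of r] by (simp add: L)
  have q_add: "q (r + s) = q r + q s" for r s using U_add[of r s] by (simp add: U)
  have c'_add: "c' (r + s) = c' r + c' s" for r s using L_add[of r s] by (simp add: L add.commute)
  have q0: "q 0 = 0" using q_add[of 0 0] by simp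
  have c'0: "c' 0 = 0" using c'_add[of 0 0] by simp
  have q_minus: "q (- r) = - q r" for r using q_add[of r "- r"] q0 by (simp add: eq_neg_iff_add_eq_0 add.commute)
  have c'_minus: "c' (- r) = - c' r" for r
    using c'_add[of r "- r"] c'0 by (simp add: eq_neg_iff_add_eq_0 add.commute)
  have q1: "q 1 = 1" using norm by (simp add: q_def)

  \<comment> \<open>Weyl element, torus and multiplicativity\<close>
  have qc: "q r * c' r' = 1" if "r * r' = 1" for r r'
  proof -
    \<comment> \<open>Both products equal \<open>((0, r), (- r', 0))\<close>. The upper right
      entries of the images give \<open>q r * (1 - q r * c' r') = 0\<close>, and \<open>q r\<close>
      is a unit.\<close>
    have "mat2 1 r 0 1 * mat2 1 0 (- r') 1 * mat2 1 r 0 1 =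
        mat2 1 0 (- r') 1 * mat2 1 r 0 1 * mat2 1 0 (- r') 1"
      using that by (simp add: algebra_simps)
    from arg_cong[OF this, of \<rho>]
    have "mat2 1 (q r) 0 1 * mat2 1 0 (- c' r') 1 * mat2 1 (q r) 0 1 =
        mat2 1 0 (- c' r') 1 * mat2 1 (q r) 0 1 * mat2 1 0 (- c' r') 1"
      by (simp add: mult SL2_mult \<rho>U \<rho>L c'_minus del: mat2_mult)
    then have "q r * (1 - q r * c' r') = 0" by (simp add: algebra_simps)
    moreover have "q r dvd 1"
    proof -
      have "r dvd 1" using that by (metis dvdI)
      then show ?thesis by (auto intro!: unitS simp: redU unit_iff)
    qed
    ultimately have "1 - q r * c' r' = 0" by (rule unit_mult_eq_0D[rotated])
    then show ?thesis by simp
  qed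
  have c'1: "c' 1 = 1" using qc[of 1 1] by (simp add: q1)
  have Weyl: "\<rho> (mat2 0 1 (- 1) 0) = mat2 0 1 (- 1) 0"
  proof -
    have "mat2 0 1 (- 1) 0 = mat2 1 1 0 1 * mat2 1 0 (- 1 :: 'a) 1 * mat2 1 1 0 1" by simp
    then have "\<rho> (mat2 0 1 (- 1) 0) = \<rho> (mat2 1 1 0 1) * \<rho> (mat2 1 0 (- 1) 1) * \<rho> (mat2 1 1 0 1)"
      by (simp add: mult SL2_mult del: mat2_mult)
    then show ?thesis by (simp add: \<rho>U \<rho>L c'_minus c'1 q1)
  qed
  \<comment> \<open>The relation in \<open>qc\<close> controls units only; the Weyl element
    conjugates \<open>u(r)\<close> to \<open>l(-r)\<close> for every \<open>r\<close>, and its image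
    is now known.\<close>
  have c'_eq: "c' r = q r" for r
  proof -
    have "mat2 0 1 (- 1) 0 * mat2 1 r 0 1 = mat2 1 0 (- r) 1 * mat2 0 1 (- 1) 0" by simp
    from arg_cong[OF this, of \<rho>] show ?thesis
      by (simp add: mult \<rho>U \<rho>L Weyl c'_minus flip: mat2_mult) simp
  qed
  have q_inv: "q r * q r' = 1" if "r * r' = 1" for r r' using qc[OF that] by (simp add: c'_eq)
  have monomial: "\<rho> (mat2 0 r (- r') 0) = mat2 0 (q r) (- q r') 0" if rr': "r * r' = 1" for r r'
  proof -
    have "mat2 0 r (- r') 0 = mat2 1 r 0 1 * mat2 1 0 (- r') 1 * mat2 1 r 0 1"
      using rr' by (simp add: algebra_simps)
    then have "\<rho> (mat2 0 r (- r') 0) = \<rho> (mat2 1 r 0 1) * \<rho> (mat2 1 0 (- r') 1) * \<rho> (mat2 1 r 0 1)"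
      by (simp add: mult SL2_mult del: mat2_mult)
    also have "\<dots> = mat2 0 (q r) (- q r') 0"
      using q_inv[OF rr'] by (simp add: \<rho>U \<rho>L c'_eq q_minus mult.commute)
    finally show ?thesis .
  qed
  have \<rho>D: "\<rho> (mat2 r 0 0 r') = mat2 (q r) 0 0 (q r')" if rr': "r * r' = 1" for r r'
  proof -
    \<comment> \<open>A torus element is a product of two monomial matrices, those for
      \<open>r\<close> and for \<open>- 1\<close>.\<close>
    have "mat2 r 0 0 r' = mat2 0 r (- r') 0 * mat2 0 (- 1) 1 0" by simp
    then have "\<rho> (mat2 r 0 0 r') = \<rho> (mat2 0 r (- r') 0) * \<rho> (mat2 0 (- 1) 1 0)"
      using rr' by (simp add: mult mult.commute del: mat2_mult)
    then show ?thesis using monomial[OF rr'] monomial[of "- 1" "- 1"] by (simp add: q_minus q1)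
  qed
  have q_mult_unit: "q (r * s) = q r * q s" if rs: "r dvd 1" "s dvd 1" for r s
  proof -
    obtain r' s' where r': "r * r' = 1" "s * s' = 1" using rs by (metis dvdE)
    have "(r * s) * (r' * s') = 1" using r' by (metis mult.assoc mult.commute mult_1)
    moreover have "mat2 (r * s) 0 0 (r' * s') = mat2 r 0 0 r' * mat2 s 0 0 s'" by simp
    ultimately have "mat2 (q (r * s)) 0 0 (q (r' * s')) = \<rho> (mat2 r 0 0 r') * \<rho> (mat2 s 0 0 s')"
      using r' by (metis mult \<rho>D mat2_in_SL2 diff_zero mult_zero_left)
    then show ?thesis using r' by (simp add: \<rho>D)
  qed
  have q_mult: "q (r * s) = q r * q s" for r s
  proof -
    obtain r1 r2 s1 s2 where u: "r1 dvd 1" "r2 dvd 1" "s1 dvd 1" "s2 dvd 1"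
      and eq: "r = r1 + r2" "s = s1 + s2" using sum by metis
    show ?thesis using u by (simp add: eq q_add q_mult_unit distrib_left distrib_right)
  qed
  have hq: "ring_hom_tc q" by (simp add: ring_hom_tc_def q_add q_mult q1)
  have "q \<in> Hom_C \<pi>R \<pi>S" using hq by (auto simp: Hom_C_def redU max_ideal_def)

  \<comment> \<open>Generation by elementary and diagonal matrices\<close>
  moreover have "\<rho> g = map_mat q g" if "g \<in> SL2 TYPE('a)" for g
  proof -
    have ok_mult: "\<rho> (g * h) = map_mat q (g * h)"
      if "g \<in> SL2 TYPE('a)" "h \<in> SL2 TYPE('a)" "\<rho> g = map_mat q g" "\<rho> h = map_mat q h" for g h
      using that map_mat_mult_2[OF hq, of g h] by (simp add: mult SL2_def)
    have ok_unit: "\<rho> (mat2 w y z u) = map_mat q (mat2 w y z u)"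
      if "w dvd 1" "w * u - y * z = 1" for w y z u
    proof -
      from that(1) obtain w' where w': "w * w' = 1" by (metis dvdE)
      have u: "u = w' + w' * y * z"
      proof -
        have "w' * (w * u) = w' * (1 + y * z)" using that(2) by (simp add: algebra_simps)
        then have "(w * w') * u = w' * (1 + y * z)" by (simp only: ac_simps)
        then have "u = w' * (1 + y * z)" by (simp only: w' mult_1)
        then show ?thesis by (simp add: algebra_simps)
      qed
      have w'': "w * (w' * e) = e" "w' * (w * e) = e" for e
        using w' by (metis mult.assoc mult.commute mult_1)+
      \<comment> \<open>LDU factorization, available because the upper left entry \<open>w\<close>
        is a unit; the determinant condition fixes \<open>u\<close>.\<close>
      let ?L = "mat2 1 0 (z * w') 1" and ?D = "mat2 w 0 0 w'" and ?U = "mat2 1 (w' * y) 0 1"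
      have in_SL2: "?L \<in> SL2 TYPE('a)" "?D \<in> SL2 TYPE('a)" "?U \<in> SL2 TYPE('a)"
        using w' by simp_all
      have "\<rho> (?D * ?U) = map_mat q (?D * ?U)"
        using in_SL2(2,3) by (rule ok_mult) (simp_all add: \<rho>D[OF w'] \<rho>U q0 q1)
      then have "\<rho> (?L * (?D * ?U)) = map_mat q (?L * (?D * ?U))"
        by (rule ok_mult[OF in_SL2(1) SL2_mult[OF in_SL2(2,3)], rotated]) (simp add: \<rho>L q0 q1 c'_eq)
      moreover have "?L * (?D * ?U) = mat2 w y z u"
        using w' by (simp add: u ac_simps w'')
      ultimately show ?thesis by (simp only:)
    qed
    from that obtain w y z u where g: "g = mat2 w y z u" "w * u - y * z = 1" by (rule SL2_cases)
    show ?thesis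
    proof (cases "w dvd 1")
      case True
      then show ?thesis using ok_unit g by simp
    next
      \<comment> \<open>Determinant 1 now makes \<open>z\<close> a unit. Adding the second row to
        the first gives the unit \<open>w + z\<close> in the corner, and multiplication by
        \<open>u(-1)\<close> undoes this.\<close>
      case False
      then have w: "\<pi>R w = 0" by (simp add: unit_iff)
      have "\<pi>R (w * u - y * z) = 1" by (simp add: g homR)
      then have "\<pi>R z \<noteq> 0" using w by (auto simp: homR)
      then have "w + z dvd 1" using w by (simp add: unit_iff homR)
      moreover have det: "(w + z) * u - (y + u) * z = 1" using g(2) by (simp add: algebra_simps)
      ultimately have "\<rho> (mat2 (w + z) (y + u) z u) = map_mat q (mat2 (w + z) (y + u) z u)"
        by (rule ok_unit)
      then have "\<rho> (mat2 1 (- 1) 0 1 * mat2 (w + z) (y + u) z u) =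
          map_mat q (mat2 1 (- 1) 0 1 * mat2 (w + z) (y + u) z u)"
        by (rule ok_mult[rotated 3]) (use det in \<open>simp_all add: \<rho>U q0 q1 q_minus\<close>)
      moreover have "mat2 1 (- 1) 0 1 * mat2 (w + z) (y + u) z u = g" by (simp add: g)
      ultimately show ?thesis by (simp only:)
    qed
  qed
  ultimately show thesis by (rule that)
qed


section \<open>Lifts induced by homomorphisms\<close>

text \<open>This is continuity of \<open>f\<close>. The preimage of a power is an ideal, so it
  suffices to check the generating products.\<close>

lemma Hom_C_ideal_pow:
  assumes "f \<in> Hom_C \<pi>R \<pi>S" "x \<in> ideal_pow (max_ideal \<pi>R) N"
  shows "f x \<in> ideal_pow (max_ideal \<pi>S) N"
  using assms(2)
proof (induction N arbitrary: x)
  case 0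
  show ?case by simp
next
  case (Suc N)
  have h: "ring_hom_tc f" and m: "f ` max_ideal \<pi>R \<subseteq> max_ideal \<pi>S"
    using assms(1) by (auto simp: Hom_C_def)
  let ?I = "{x. f x \<in> ideal_pow (max_ideal \<pi>S) (Suc N)}"
  have "is_ideal ?I"
    unfolding is_ideal_def mem_Collect_eq ring_hom_tcD[OF h]
    by (blast intro: ideal_pow_zero ideal_pow_add ideal_pow_mult_left)
  moreover have "{a * b | a b. a \<in> max_ideal \<pi>R \<and> b \<in> ideal_pow (max_ideal \<pi>R) N} \<subseteq> ?I"
    using m Suc.IH
    by (auto simp: ring_hom_tcD[OF h] image_subset_iff simp del: ideal_pow.simps intro!: ideal_pow_mult)
  ultimately have "ideal_pow (max_ideal \<pi>R) (Suc N) \<subseteq> ?I"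
    unfolding ideal_pow.simps(2)[of "max_ideal \<pi>R"] by (rule ideal_gen_least)
  then show ?case using Suc.prems by blast
qed

text \<open>The image of the adjugate is the inverse, and continuity holds with the same exponent on
  both sides.\<close>

lemma is_lift_map_mat:
  assumes f: "f \<in> Hom_C \<pi>R \<pi>S"
  shows "is_lift \<pi>R (SL2 TYPE('a::comm_ring_1)) (map_mat \<pi>R) 2 \<pi>S (map_mat f)"
  unfolding is_lift_def
proof (intro conjI ballI)
  have h: "ring_hom_tc f" and r: "\<And>x. \<pi>S (f x) = \<pi>R x" using f by (auto simp: Hom_C_def)
  note hom = ring_hom_tcD[OF h]
  fix g assume g: "g \<in> SL2 TYPE('a)"
  then show "map_mat f g \<in> carrier_mat 2 2" by (simp add: SL2_def)
  obtain a b c d where gm: "g = mat2 a b c d" "a * d - b * c = 1" by (rule SL2_cases[OF g])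
  have "f a * f d - f b * f c = 1" using arg_cong[OF gm(2), of f] by (simp add: hom)
  then have "inverts_mat (map_mat f g) (map_mat f (mat2 d (- b) (- c) a)) \<and>
    inverts_mat (map_mat f (mat2 d (- b) (- c) a)) (map_mat f g)"
    by (simp add: inverts_mat_def gm(1) one_mat2 hom algebra_simps)
  then show "invertible_mat (map_mat f g)" unfolding invertible_mat_def by (auto simp: gm(1))
  show "map_mat \<pi>S (map_mat f g) = map_mat \<pi>R g" by (simp add: gm(1) r)
  fix h' assume "h' \<in> SL2 TYPE('a)"
  then show "map_mat f (g * h') = map_mat f g * map_mat f h'"
    using g by (simp add: map_mat_mult_2[OF h] SL2_def)
next
  have h: "ring_hom_tc f" using f by (auto simp: Hom_C_def)
  have "mat_cong (max_ideal \<pi>S) N (map_mat f h') (map_mat f g)"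
    if "mat_cong (max_ideal \<pi>R) N h' g" for N and h' g :: "'a mat"
    using that Hom_C_ideal_pow[OF f] by (auto simp: mat_cong_def simp flip: ring_hom_tcD[OF h])
  then show "adic_continuous (max_ideal \<pi>R) (SL2 TYPE('a)) (max_ideal \<pi>S) (map_mat f)"
    unfolding adic_continuous_def by blast
qed

section \<open>Strict equivalence is an equivalence relation\<close>

text \<open>Stating congruence to the identity as a condition on the reduction makes it pass to
  products and inverses, since reduction is multiplicative.\<close>

lemma strictly_equiv_iff:
  assumes h: "ring_hom_tc \<pi>S"
  shows "strictly_equiv \<pi>S 2 G \<rho> \<rho>' \<longleftrightarrow>
    (\<exists>P Q. P \<in> carrier_mat 2 2 \<and> Q \<in> carrier_mat 2 2 \<and> P * Q = 1\<^sub>m 2 \<and> Q * P = 1\<^sub>m 2 \<and>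
       map_mat \<pi>S P = 1\<^sub>m 2 \<and> (\<forall>g\<in>G. \<rho>' g = P * \<rho> g * Q))"
proof -
  have "(\<forall>i<2. \<forall>j<2. (P - 1\<^sub>m 2) $$ (i, j) \<in> max_ideal \<pi>S) \<longleftrightarrow> map_mat \<pi>S P = 1\<^sub>m 2"
    if P: "P \<in> carrier_mat 2 2" for P
  proof -
    obtain a b c d where Pm: "P = mat2 a b c d" using mat2_expand[OF P] by blast
    have all_less_2: "(\<forall>i<2. X i) \<longleftrightarrow> X 0 \<and> X (Suc 0)" for X :: "nat \<Rightarrow> bool"
      by (auto simp: less_2_cases_iff)
    show ?thesis by (simp add: Pm one_mat2 max_ideal_def all_less_2 ring_hom_tcD[OF h])
  qed
  then show ?thesis unfolding strictly_equiv_def by (intro ex_cong1) blast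
qed

lemma map_mat_one_2: "ring_hom_tc f \<Longrightarrow> map_mat f (1\<^sub>m 2) = 1\<^sub>m 2"
  by (simp add: one_mat2 ring_hom_tcD)

lemma map_mat_conj_2:
  assumes h: "ring_hom_tc f" and "P \<in> carrier_mat 2 2" "Q \<in> carrier_mat 2 2" "A \<in> carrier_mat 2 2"
    and "map_mat f P = 1\<^sub>m 2" "map_mat f Q = 1\<^sub>m 2"
  shows "map_mat f (P * A * Q) = map_mat f A"
  using assms by (simp add: map_mat_mult_2[OF h])

lemma map_mat_inverse_2:
  assumes h: "ring_hom_tc f" and "P \<in> carrier_mat 2 2" "Q \<in> carrier_mat 2 2" "Q * P = 1\<^sub>m 2"
    and P: "map_mat f P = 1\<^sub>m 2"
  shows "map_mat f Q = 1\<^sub>m 2"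
proof -
  have "map_mat f Q = map_mat f Q * map_mat f P" using assms(3) by (simp add: P)
  also have "\<dots> = map_mat f (Q * P)" using assms by (intro map_mat_mult_2[symmetric])
  finally show ?thesis by (simp add: assms(4) map_mat_one_2[OF h])
qed

lemma strictly_equiv_refl:
  assumes h: "ring_hom_tc \<pi>S" and car: "\<And>g. g \<in> G \<Longrightarrow> \<rho> g \<in> carrier_mat 2 2"
  shows "strictly_equiv \<pi>S 2 G \<rho> \<rho>"
  unfolding strictly_equiv_iff[OF h]
  by (intro exI[of _ "1\<^sub>m 2"]) (auto simp: map_mat_one_2[OF h] left_mult_one_mat[OF car]
      right_mult_one_mat[OF car])

lemma strictly_equiv_sym:
  assumes h: "ring_hom_tc \<pi>S" and car: "\<And>g. g \<in> G \<Longrightarrow> \<rho> g \<in> carrier_mat 2 2"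
    and "strictly_equiv \<pi>S 2 G \<rho> \<rho>'"
  shows "strictly_equiv \<pi>S 2 G \<rho>' \<rho>"
proof -
  obtain P Q where PQ: "P \<in> carrier_mat 2 2" "Q \<in> carrier_mat 2 2" "P * Q = 1\<^sub>m 2" "Q * P = 1\<^sub>m 2"
    "map_mat \<pi>S P = 1\<^sub>m 2" "\<forall>g\<in>G. \<rho>' g = P * \<rho> g * Q"
    using assms(3) unfolding strictly_equiv_iff[OF h] by blast
  have "map_mat \<pi>S Q = 1\<^sub>m 2" using map_mat_inverse_2[OF h] PQ by blast
  moreover have "\<rho> g = Q * \<rho>' g * P" if "g \<in> G" for g
    using conj_conj[of P 2 Q Q P "\<rho> g"] PQ that car[OF that] by simp
  ultimately show ?thesis unfolding strictly_equiv_iff[OF h] using PQ by blast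
qed

lemma strictly_equiv_trans:
  assumes h: "ring_hom_tc \<pi>S" and car: "\<And>g. g \<in> G \<Longrightarrow> \<rho> g \<in> carrier_mat 2 2"
    and "strictly_equiv \<pi>S 2 G \<rho> \<rho>'" "strictly_equiv \<pi>S 2 G \<rho>' \<rho>''"
  shows "strictly_equiv \<pi>S 2 G \<rho> \<rho>''"
proof -
  obtain P Q where PQ: "P \<in> carrier_mat 2 2" "Q \<in> carrier_mat 2 2" "P * Q = 1\<^sub>m 2" "Q * P = 1\<^sub>m 2"
    "map_mat \<pi>S P = 1\<^sub>m 2" "\<forall>g\<in>G. \<rho>' g = P * \<rho> g * Q"
    using assms(3) unfolding strictly_equiv_iff[OF h] by blast
  obtain P' Q' where PQ': "P' \<in> carrier_mat 2 2" "Q' \<in> carrier_mat 2 2" "P' * Q' = 1\<^sub>m 2"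
    "Q' * P' = 1\<^sub>m 2" "map_mat \<pi>S P' = 1\<^sub>m 2" "\<forall>g\<in>G. \<rho>'' g = P' * \<rho>' g * Q'"
    using assms(4) unfolding strictly_equiv_iff[OF h] by blast
  show ?thesis unfolding strictly_equiv_iff[OF h]
  proof (intro exI conjI ballI)
    show "(P' * P) * (Q * Q') = 1\<^sub>m 2"
      using conj_conj[of P 2 P' Q Q' "1\<^sub>m 2"] PQ PQ' by simp
    show "(Q * Q') * (P' * P) = 1\<^sub>m 2"
      using conj_conj[of Q' 2 Q P' P "1\<^sub>m 2"] PQ PQ' by simp
    show "map_mat \<pi>S (P' * P) = 1\<^sub>m 2" using PQ PQ' by (simp add: map_mat_mult_2[OF h])
    show "\<rho>'' g = (P' * P) * \<rho> g * (Q * Q')" if "g \<in> G" for g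
      using conj_conj[of P 2 P' Q Q' "\<rho> g"] PQ PQ' car[OF that] that by simp
  qed (use PQ PQ' in auto)
qed

lemma equiv_lift_rel:
  assumes h: "ring_hom_tc \<pi>S"
  shows "equiv {\<rho>. is_lift \<pi>R G \<rho>bar 2 \<pi>S \<rho>} (lift_rel \<pi>R G \<rho>bar 2 \<pi>S)"
proof -
  have car: "\<rho> g \<in> carrier_mat 2 2" if "is_lift \<pi>R G \<rho>bar 2 \<pi>S \<rho>" "g \<in> G" for \<rho> g
    using that by (simp add: is_lift_def)
  show ?thesis
  proof (rule equivI)
    show "refl_on {\<rho>. is_lift \<pi>R G \<rho>bar 2 \<pi>S \<rho>} (lift_rel \<pi>R G \<rho>bar 2 \<pi>S)"
      unfolding refl_on_def lift_rel_def by (auto intro: strictly_equiv_refl[OF h car])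
    show "sym (lift_rel \<pi>R G \<rho>bar 2 \<pi>S)"
      unfolding lift_rel_def by (rule symI) (auto intro: strictly_equiv_sym[OF h car])
    show "trans (lift_rel \<pi>R G \<rho>bar 2 \<pi>S)"
      unfolding lift_rel_def by (rule transI) (auto intro: strictly_equiv_trans[OF h car])
  qed (auto simp: lift_rel_def)
qed

section \<open>Injectivity by traces\<close>

text \<open>Sorted by the entries of the middle matrix \<open>A\<close>, the trace of
  \<open>P * A * Q\<close> has the entries of \<open>Q * P\<close> as coefficients.\<close>

lemma trace_conj_2:
  fixes a :: "'a::comm_ring_1"
  assumes "P \<in> carrier_mat 2 2" "Q \<in> carrier_mat 2 2" "Q * P = 1\<^sub>m 2"
    and "mat2 a' b' c' d' = P * mat2 a b c d * Q"
  shows "a' + d' = a + d"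
proof -
  obtain p1 p2 p3 p4 q1 q2 q3 q4 where P: "P = mat2 p1 p2 p3 p4" and Q: "Q = mat2 q1 q2 q3 q4"
    using mat2_expand assms(1,2) by blast
  have e: "q1 * p1 + q2 * p3 = 1" "q1 * p2 + q2 * p4 = 0" "q3 * p1 + q4 * p3 = 0" "q3 * p2 + q4 * p4 = 1"
    using assms(3) by (simp_all add: P Q one_mat2)
  have "a' + d' = a * (q1 * p1 + q2 * p3) + c * (q1 * p2 + q2 * p4) + b * (q3 * p1 + q4 * p3)
      + d * (q3 * p2 + q4 * p4)"
    using assms(4) by (simp add: P Q algebra_simps)
  then show ?thesis by (simp add: e)
qed

text \<open>The matrix \<open>((r, -1), (1, 0))\<close> has trace \<open>r\<close>, so the trace of a lift of the form
  \<open>f \<circ> \<iota>\<close> recovers \<open>f\<close>.\<close>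

lemma hom_eq_of_strictly_equiv:
  fixes f f' :: "'a::comm_ring_1 \<Rightarrow> 'b::comm_ring_1"
  assumes h: "ring_hom_tc \<pi>S" "ring_hom_tc f" "ring_hom_tc f'"
    and "strictly_equiv \<pi>S 2 (SL2 TYPE('a)) (map_mat f) (map_mat f')"
  shows "f = f'"
proof
  fix r
  obtain P Q where PQ: "P \<in> carrier_mat 2 2" "Q \<in> carrier_mat 2 2" "Q * P = 1\<^sub>m 2"
    "\<forall>g\<in>SL2 TYPE('a). map_mat f' g = P * map_mat f g * Q"
    using assms(4) unfolding strictly_equiv_iff[OF h(1)] by blast
  have "map_mat f' (mat2 r (- 1) 1 0) = P * map_mat f (mat2 r (- 1) 1 0) * Q"
    using PQ(4) by (rule bspec) simp
  then show "f r = f' r" using trace_conj_2[OF PQ(1-3)]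
    by (simp add: ring_hom_tcD[OF h(2)] ring_hom_tcD[OF h(3)]) force
qed

section \<open>Fourth powers in finite fields\<close>

text \<open>Multiplication by \<open>x\<close> permutes the nonzero elements, so it preserves their
  product.\<close>

lemma finite_field_power_eq_1:
  fixes x :: "'k::{field,finite}"
  assumes "x \<noteq> 0"
  shows "x ^ (card (UNIV :: 'k set) - 1) = 1"
proof -
  let ?U = "UNIV - {0 :: 'k}"
  have "bij_betw ((*) x) ?U ?U"
    by (rule bij_betwI[where g = "(*) (inverse x)"]) (use assms in \<open>auto simp: field_simps\<close>)
  then have "(\<Prod>y\<in>?U. x * y) = (\<Prod>y\<in>?U. y)" by (rule prod.reindex_bij_betw)
  moreover have "(\<Prod>y\<in>?U. x * y) = x ^ card ?U * (\<Prod>y\<in>?U. y)" by (simp add: prod.distrib)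
  moreover have "(\<Prod>y\<in>?U. y) \<noteq> 0" by simp
  ultimately show ?thesis by (simp add: card_Diff_subset)
qed

text \<open>Otherwise every nonzero element is a root of \<open>X^4 - 1\<close>, so the field has at
  most 5 elements and hence exactly 4. There \<open>x^3 = 1\<close> as well, which leaves only
  \<open>x = 1\<close>.\<close>

lemma exists_power4_neq_1:
  assumes "card (UNIV :: 'k::{field,finite} set) \<notin> {2, 3, 5}"
  shows "\<exists>x::'k. x \<noteq> 0 \<and> x ^ 4 \<noteq> 1"
proof (rule ccontr)
  assume "\<not> ?thesis"
  then have all: "x ^ 4 = 1" if "x \<noteq> 0" for x :: 'k using that by blast
  let ?p = "monom 1 4 - 1 :: 'k poly"
  have deg: "degree ?p \<le> 4" by (intro degree_diff_le degree_monom_le) simp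
  have "coeff ?p 4 \<noteq> 0" by simp
  then have "?p \<noteq> 0" by fastforce
  then have "card {x. poly ?p x = 0} \<le> 4" using card_poly_roots_bound deg le_trans by blast
  moreover have "UNIV - {0} \<subseteq> {x. poly ?p x = 0}" using all by (auto simp: poly_monom)
  ultimately have "card (UNIV - {0 :: 'k}) \<le> 4" by (meson card_mono finite le_trans)
  then have "card (UNIV :: 'k set) \<le> 5" by (simp add: card_Diff_subset)
  moreover have "card {0, 1 :: 'k} \<le> card (UNIV :: 'k set)" by (intro card_mono) auto
  ultimately have card: "card (UNIV :: 'k set) = 4" using assms by auto
  have "x = 1" if "x \<noteq> 0" for x :: 'k
  proof -
    have "x ^ 3 = 1" using finite_field_power_eq_1[OF that] by (simp add: card)
    then show ?thesis using all[OF that] by (simp add: eval_nat_numeral)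
  qed
  then have "UNIV \<subseteq> {0, 1 :: 'k}" by blast
  then have "card (UNIV :: 'k set) \<le> card {0, 1 :: 'k}" by (intro card_mono) auto
  then show False by (simp add: card)
qed

section \<open>Surjectivity: normalizing a lift\<close>

lemma lift_strictly_equiv_hom:
  fixes \<pi>R :: "'a::comm_ring_1 \<Rightarrow> 'k::{field,finite}" and \<pi>S :: "'b::comm_ring_1 \<Rightarrow> 'k"
  assumes CR: "in_C \<pi>R" and CS: "in_C \<pi>S" and q: "card (UNIV :: 'k set) \<notin> {2, 3, 5}"
    and lift: "is_lift \<pi>R (SL2 TYPE('a)) (map_mat \<pi>R) 2 \<pi>S \<rho>"
  obtains f where "f \<in> Hom_C \<pi>R \<pi>S" "strictly_equiv \<pi>S 2 (SL2 TYPE('a)) \<rho> (map_mat f)"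
proof -
  have hR: "ring_hom_tc \<pi>R" and hS: "ring_hom_tc \<pi>S" and surj: "surj \<pi>R"
    using CR CS by (auto simp: in_C_def)
  note homR = ring_hom_tcD[OF hR] and homS = ring_hom_tcD[OF hS]
  have car: "\<rho> g \<in> carrier_mat 2 2" and red: "map_mat \<pi>S (\<rho> g) = map_mat \<pi>R g"
    if "g \<in> SL2 TYPE('a)" for g using lift that by (simp_all add: is_lift_def)
  have mult: "\<rho> (g * h) = \<rho> g * \<rho> h" if "g \<in> SL2 TYPE('a)" "h \<in> SL2 TYPE('a)" for g h
    using lift that by (simp add: is_lift_def)
  obtain x :: 'k where x: "x \<noteq> 0" "x ^ 4 \<noteq> 1" using exists_power4_neq_1[OF q] by blast
  obtain a where a: "\<pi>R a = x" using surj by (metis surjD)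
  obtain a' where a': "a * a' = 1" using in_C_unit[OF CR, of a] a x(1) by (metis dvdE)
  have xa': "x * \<pi>R a' = 1" using homR(2)[of a a'] a by (simp add: a' homR)
  let ?D = "mat2 a 0 0 a'"
  have D: "?D \<in> SL2 TYPE('a)" by (simp add: a')
  have "map_mat \<pi>S (\<rho> ?D) = mat2 x 0 0 (\<pi>R a')" by (simp only: red[OF D]) (simp add: a homR)
  \<comment> \<open>Equality would give \<open>x^2 = 1\<close>.\<close>
  moreover have "x \<noteq> \<pi>R a'" using x(2) xa' by (auto simp: power4_eq_xxxx)
  ultimately obtain P Q \<alpha> \<delta> where PQ: "P \<in> carrier_mat 2 2" "Q \<in> carrier_mat 2 2" "P * Q = 1\<^sub>m 2"
    "Q * P = 1\<^sub>m 2" "map_mat \<pi>S P = 1\<^sub>m 2" and PDQ: "P * \<rho> ?D * Q = mat2 \<alpha> 0 0 \<delta>"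
    using diagonalize[OF CS car[OF D]] by metis
  define \<sigma> where "\<sigma> g = P * \<rho> g * Q" for g
  have \<rho>\<sigma>: "strictly_equiv \<pi>S 2 (SL2 TYPE('a)) \<rho> \<sigma>"
    unfolding strictly_equiv_iff[OF hS] \<sigma>_def using PQ by blast
  have redQ: "map_mat \<pi>S Q = 1\<^sub>m 2" using map_mat_inverse_2[OF hS] PQ by blast
  have car\<sigma>: "\<sigma> g \<in> carrier_mat 2 2" and red\<sigma>: "map_mat \<pi>S (\<sigma> g) = map_mat \<pi>R g"
    if "g \<in> SL2 TYPE('a)" for g
    using PQ(1,2) map_mat_conj_2[OF hS PQ(1,2) car[OF that] PQ(5) redQ] car[OF that] red[OF that]
    by (auto simp: \<sigma>_def simp del: assoc_mult_mat)
  have mult\<sigma>: "\<sigma> (g * h) = \<sigma> g * \<sigma> h" if "g \<in> SL2 TYPE('a)" "h \<in> SL2 TYPE('a)" for g h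
    using that conj_mult[of P 2 Q "\<rho> g" "\<rho> h"] PQ car by (simp add: \<sigma>_def mult)
  \<comment> \<open>The entry \<open>b\<close> is 1 modulo the maximal ideal, so conjugation by
    \<open>diag (1/b, 1)\<close> is strict. It fixes the diagonal image of \<open>?D\<close> and
    scales \<open>b\<close> to 1.\<close>
  define b where "b = \<sigma> (mat2 1 1 0 1) $$ (0, 1)"
  obtain b1 b3 b4 where \<sigma>U: "\<sigma> (mat2 1 1 0 1) = mat2 b1 b b3 b4"
    using mat2_expand[OF car\<sigma>, of "mat2 1 1 0 1"] by (simp add: b_def)
  have \<pi>b: "\<pi>S b = 1" using red\<sigma>[of "mat2 1 1 0 1"] by (simp add: \<sigma>U homR)
  then obtain b' where b': "b * b' = 1" using in_C_unit[OF CS, of b] by (metis dvdE zero_neq_one)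
  have \<pi>b': "\<pi>S b' = 1" using homS(2)[of b b'] by (simp add: b' homS \<pi>b)
  let ?E = "mat2 b' 0 0 1" and ?E' = "mat2 b 0 0 1"
  have E: "?E * ?E' = 1\<^sub>m 2" "?E' * ?E = 1\<^sub>m 2" "map_mat \<pi>S ?E = 1\<^sub>m 2" "map_mat \<pi>S ?E' = 1\<^sub>m 2"
    using b' by (simp_all add: one_mat2 mult.commute \<pi>b \<pi>b' homS)
  define \<tau> where "\<tau> g = ?E * \<sigma> g * ?E'" for g
  have \<sigma>\<tau>: "strictly_equiv \<pi>S 2 (SL2 TYPE('a)) \<sigma> \<tau>"
    unfolding strictly_equiv_iff[OF hS] \<tau>_def
    by (intro exI[of _ ?E] exI[of _ ?E'] conjI ballI refl E mat2_carrier)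
  have car\<tau>: "\<tau> g \<in> carrier_mat 2 2" if "g \<in> SL2 TYPE('a)" for g
    unfolding \<tau>_def by (intro mult_carrier_mat[of _ 2 2 _ 2] mat2_carrier car\<sigma> that)
  have red\<tau>: "map_mat \<pi>S (\<tau> g) = map_mat \<pi>R g" if "g \<in> SL2 TYPE('a)" for g
    unfolding \<tau>_def red\<sigma>[OF that, symmetric]
    by (intro map_mat_conj_2[OF hS] E mat2_carrier car\<sigma> that)
  have mult\<tau>: "\<tau> (g * h) = \<tau> g * \<tau> h" if "g \<in> SL2 TYPE('a)" "h \<in> SL2 TYPE('a)" for g h
    using that conj_mult[of ?E 2 ?E' "\<sigma> g" "\<sigma> h"] E car\<sigma> by (simp add: \<tau>_def mult\<sigma> del: mat2_mult)
  have "\<tau> ?D = mat2 \<alpha> 0 0 \<delta>"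
    using b' by (simp add: \<tau>_def \<sigma>_def PDQ) (metis mult.assoc mult.commute mult_1)
  moreover have "\<tau> (mat2 1 1 0 1) $$ (0, 1) = 1"
    using b' by (simp add: \<tau>_def \<sigma>U mult.commute)
  ultimately obtain f where f: "f \<in> Hom_C \<pi>R \<pi>S" "\<And>g. g \<in> SL2 TYPE('a) \<Longrightarrow> \<tau> g = map_mat f g"
    using hom_of_normalized_lift[OF CR CS mult\<tau> car\<tau> red\<tau> a' x(2)[folded a]] by blast
  have "strictly_equiv \<pi>S 2 (SL2 TYPE('a)) \<rho> \<tau>"
    by (rule strictly_equiv_trans[OF hS car \<rho>\<sigma> \<sigma>\<tau>])
  then have "strictly_equiv \<pi>S 2 (SL2 TYPE('a)) \<rho> (map_mat f)"
    using f(2) by (simp add: strictly_equiv_def)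
  with f(1) show thesis by (rule that)
qed

section \<open>Bijectivity at an arbitrary object \<open>\<pi>S\<close>\<close>

theorem mainTheorem7:
  fixes \<pi>R :: "'a::comm_ring_1 \<Rightarrow> 'k::{field,finite}"
    and \<pi>S :: "'b::comm_ring_1 \<Rightarrow> 'k"
  assumes "in_C \<pi>R"
    and "in_C \<pi>S"
    and "card (UNIV :: 'k set) \<notin> {2, 3, 5}"
  shows "bij_betw
           (induced_class \<pi>R (SL2 TYPE('a)) (\<lambda>g. map_mat \<pi>R g) 2 \<pi>S (\<lambda>g. g))
           (Hom_C \<pi>R \<pi>S)
           (Def_lifts \<pi>R (SL2 TYPE('a)) (\<lambda>g. map_mat \<pi>R g) 2 \<pi>S)"
proof -
  let ?G = "SL2 TYPE('a)"
  let ?r = "lift_rel \<pi>R ?G (map_mat \<pi>R) 2 \<pi>S"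
  have hS: "ring_hom_tc \<pi>S" using assms(2) by (simp add: in_C_def)
  note eq = equiv_lift_rel[OF hS, of \<pi>R ?G "map_mat \<pi>R"]
  have "inj_on (\<lambda>f. ?r `` {map_mat f}) (Hom_C \<pi>R \<pi>S)"
  proof (rule inj_onI)
    fix f f' assume f: "f \<in> Hom_C \<pi>R \<pi>S" "f' \<in> Hom_C \<pi>R \<pi>S"
      and cl: "?r `` {map_mat f} = ?r `` {map_mat f'}"
    \<comment> \<open>Equal classes have strictly equivalent representatives, to which the trace
      argument applies.\<close>
    have "(map_mat f, map_mat f') \<in> ?r"
      using eq_equiv_class[OF cl eq] is_lift_map_mat[OF f(2)] by simp
    then show "f = f'"
      using hom_eq_of_strictly_equiv[OF hS] f by (auto simp: lift_rel_def Hom_C_def)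
  qed
  moreover have "(\<lambda>f. ?r `` {map_mat f}) ` Hom_C \<pi>R \<pi>S = Def_lifts \<pi>R ?G (map_mat \<pi>R) 2 \<pi>S"
  proof (intro equalityI subsetI)
    fix X assume "X \<in> (\<lambda>f. ?r `` {map_mat f}) ` Hom_C \<pi>R \<pi>S"
    then show "X \<in> Def_lifts \<pi>R ?G (map_mat \<pi>R) 2 \<pi>S"
      using is_lift_map_mat by (auto simp: Def_lifts_def intro!: quotientI)
  next
    fix X assume "X \<in> Def_lifts \<pi>R ?G (map_mat \<pi>R) 2 \<pi>S"
    then obtain \<rho> where \<rho>: "is_lift \<pi>R ?G (map_mat \<pi>R) 2 \<pi>S \<rho>" "X = ?r `` {\<rho>}"
      by (auto simp: Def_lifts_def elim: quotientE)
    obtain f where f: "f \<in> Hom_C \<pi>R \<pi>S" "strictly_equiv \<pi>S 2 ?G \<rho> (map_mat f)"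
      by (rule lift_strictly_equiv_hom[OF assms \<rho>(1)])
    then have "(\<rho>, map_mat f) \<in> ?r" using \<rho>(1) is_lift_map_mat by (simp add: lift_rel_def)
    then have "X = ?r `` {map_mat f}" using equiv_class_eq[OF eq] \<rho>(2) by simp
    then show "X \<in> (\<lambda>f. ?r `` {map_mat f}) ` Hom_C \<pi>R \<pi>S" using f(1) by blast
  qed
  ultimately show ?thesis unfolding bij_betw_def induced_class_def by simp
qed

end
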